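(* Let $(A_n)_{n\in\mathbb{N}}$ be a sequence of complex square matrices with spectra in the open unit disc $\mathbb{D}$ which is interpolating for $\mathrm{H}^\infty$. Then there exists a sequence $(f_n)_{n\in\mathbb{N}}$ in $\mathrm{H}^\infty$ such that \[ \sup_{z\in\mathbb{D}}\sum_{n\in\mathbb{N}}|f_n(z)|<\infty \] and $f_n(A_k)=\delta_{n,k}\cdot\mathrm{Id}$ for all $n,k\in\mathbb{N}$, where $\delta_{n,k}$ is the Kronecker delta and $\mathrm{Id}$ is the identity matrix of the size of $A_k$.
   Context: $\mathrm{H}^\infty$ is the space of bounded analytic functions on the unit disc $\mathbb{D}$. For $f$ holomorphic on $\mathbb{D}$ and a square matrix $M$ with spectrum in $\mathbb{D}$, $f(M)$ is defined by the Riesz–Dunford holomorphic functional calculus; equivalently by the power series of $f$ at $0$. Interpolating: a sequence $(A_n)_{n\in\mathbb{N}}$ of complex square matrices (of perhaps different dimensions) with spectra in $\mathbb{D}$ is interpolating for $\mathrm{H}^\infty$ if for every bounded sequence $(\phi_n)_{n\in\mathbb{N}}$ in $\mathrm{H}^\infty$ there exists $\varphi\in\mathrm{H}^\infty$ with $\varphi(A_n)=\phi_n(A_n)$ for all $n\in\mathbb{N}$. *)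

theory Defs
  imports "HOL-Complex_Analysis.Complex_Analysis" "Jordan_Normal_Form.Spectral_Radius"
begin

definition Hinf :: "(complex \<Rightarrow> complex) set" where
  "Hinf = {f. f holomorphic_on ball 0 1 \<and> bounded (f ` ball 0 1)}"

definition Hinf_norm :: "(complex \<Rightarrow> complex) \<Rightarrow> real" where
  "Hinf_norm f = (SUP z\<in>ball 0 1. cmod (f z))"

text \<open>
  The holomorphic functional calculus \<open>f(M)\<close> for \<open>f\<close> holomorphic on the unit disc and \<open>M\<close> a square
  matrix with spectrum in the unit disc, given by the Taylor series of \<open>f\<close> at \<open>0\<close>, summed entrywise:
  \<open>f(M) = (\<Sum>k. (f\<^bsup>(k)\<^esup>(0) / k!) M\<^sup>k)\<close>.
  The series converges for such \<open>f\<close> and \<open>M\<close>, since the spectral radius of \<open>M\<close> is less than \<open>1\<close>;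
  the value carries no meaning for other arguments. It depends only on \<open>f\<close> near \<open>0\<close>, so the
  values of \<open>f\<close> outside the disc are irrelevant.
\<close>
definition hol_calc :: "(complex \<Rightarrow> complex) \<Rightarrow> complex mat \<Rightarrow> complex mat" where
  "hol_calc f M = Matrix.mat (dim_row M) (dim_col M)
     (\<lambda>(i, j). \<Sum>k. (deriv ^^ k) f 0 / fact k * (M ^\<^sub>m k) $$ (i, j))"

text \<open>Meant for sequences of square matrices with spectra in the unit disc.\<close>
definition interpolating_Hinf :: "(nat \<Rightarrow> complex mat) \<Rightarrow> bool" where
  "interpolating_Hinf A \<longleftrightarrow>
     (\<forall>\<phi>. (\<forall>n. \<phi> n \<in> Hinf) \<and> bounded (range (\<lambda>n. Hinf_norm (\<phi> n))) \<longrightarrow>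
        (\<exists>\<psi>\<in>Hinf. \<forall>n. hol_calc \<psi> (A n) = hol_calc (\<phi> n) (A n)))"

end

theory Submission
  imports Defs "HOL-Library.Diagonal_Subsequence"
begin

text \<open>
  Since the hypothesis yields, for each bounded scalar sequence \<open>x\<close>, some \<open>\<phi>\<close> with
  \<open>\<phi>(A\<^sub>k) = x\<^sub>k Id\<close>, a Baire category argument combined with Montel's theorem gives such a \<open>\<phi>\<close> with
  sup norm at most a constant \<open>C\<close>, uniformly in \<open>x\<close> with values in the closed unit disc. Let \<open>\<omega>\<close> be a
  primitive \<open>N\<close>-th root of unity and choose \<open>F\<^sub>j\<close> bounded by \<open>C\<close> with \<open>F\<^sub>j(A\<^sub>k) = \<omega>\<^bsup>jk\<^esup> Id\<close>. Following
  Varopoulos, put \<open>f\<^sub>k = (1/N \<Sum>\<^sub>j \<omega>\<^bsup>-jk\<^esup> F\<^sub>j)\<^sup>2\<close>: multiplicativity of the functional calculus gives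
  \<open>f\<^sub>k(A\<^sub>l) = \<delta>\<^sub>k\<^sub>l Id\<close> for \<open>k, l < N\<close>, and by Parseval
  \<open>\<Sum>\<^sub>k \<bar>f\<^sub>k(z)\<bar> = 1/N \<Sum>\<^sub>j \<bar>F\<^sub>j(z)\<bar>\<^sup>2 \<le> C\<^sup>2\<close>. A diagonal normal family argument lets \<open>N\<close> tend to infinity.
\<close>

section \<open>Bounded analytic functions and their Taylor coefficients\<close>

text \<open>The bound \<open>M\<close> is an explicit parameter, so estimates add and multiply
  without handling suprema. For fixed \<open>M\<close> the set is a normal family, closed under
  locally uniform limits.\<close>

definition Hinf_ball :: "real \<Rightarrow> (complex \<Rightarrow> complex) set" where
  "Hinf_ball M = {f. f holomorphic_on ball 0 1 \<and> (\<forall>z\<in>ball 0 1. cmod (f z) \<le> M)}"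

lemma Hinf_iff_Hinf_ball: "f \<in> Hinf \<longleftrightarrow> (\<exists>M. f \<in> Hinf_ball M)"
  by (auto simp: Hinf_def Hinf_ball_def bounded_iff)

lemma Hinf_ballD:
  assumes "f \<in> Hinf_ball M"
  shows "f holomorphic_on ball 0 1" "cmod z < 1 \<Longrightarrow> cmod (f z) \<le> M"
  using assms by (auto simp: Hinf_ball_def)

lemma Hinf_ball_nonneg: "f \<in> Hinf_ball M \<Longrightarrow> 0 \<le> M"
  using Hinf_ballD(2)[of f M 0] norm_ge_zero[of "f 0"] by (simp del: norm_ge_zero)

lemma Hinf_ball_const: "(\<lambda>_. c) \<in> Hinf_ball (cmod c)"
  by (auto simp: Hinf_ball_def)

lemma Hinf_ball_add:
  "f \<in> Hinf_ball M \<Longrightarrow> g \<in> Hinf_ball N \<Longrightarrow> (\<lambda>z. f z + g z) \<in> Hinf_ball (M + N)"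
  by (auto simp: Hinf_ball_def intro!: holomorphic_intros norm_triangle_mono)

lemma Hinf_ball_mult:
  "f \<in> Hinf_ball M \<Longrightarrow> g \<in> Hinf_ball N \<Longrightarrow> (\<lambda>z. f z * g z) \<in> Hinf_ball (M * N)"
  using Hinf_ball_nonneg[of f M]
  by (auto simp: Hinf_ball_def norm_mult intro!: holomorphic_intros mult_mono)

lemma Hinf_ball_sum:
  assumes "\<And>j. j \<in> S \<Longrightarrow> F j \<in> Hinf_ball (M j)"
  shows "(\<lambda>z. \<Sum>j\<in>S. F j z) \<in> Hinf_ball (\<Sum>j\<in>S. M j)"
  using assms by (auto simp: Hinf_ball_def intro!: holomorphic_intros sum_norm_le)

lemma Hinf_const [simp, intro]: "(\<lambda>_. c) \<in> Hinf"
  using Hinf_ball_const Hinf_iff_Hinf_ball by blast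

lemma Hinf_add [intro]: "f \<in> Hinf \<Longrightarrow> g \<in> Hinf \<Longrightarrow> (\<lambda>z. f z + g z) \<in> Hinf"
  using Hinf_ball_add Hinf_iff_Hinf_ball by blast

lemma Hinf_mult [intro]: "f \<in> Hinf \<Longrightarrow> g \<in> Hinf \<Longrightarrow> (\<lambda>z. f z * g z) \<in> Hinf"
  using Hinf_ball_mult Hinf_iff_Hinf_ball by blast

lemma Hinf_sum [intro]:
  assumes "\<And>j. j \<in> S \<Longrightarrow> F j \<in> Hinf"
  shows "(\<lambda>z. \<Sum>j\<in>S. F j z) \<in> Hinf"
  using assms Hinf_ball_sum[of S F] unfolding Hinf_iff_Hinf_ball by metis

lemma Hinf_holomorphic: "f \<in> Hinf \<Longrightarrow> f holomorphic_on ball 0 1"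
  by (simp add: Hinf_def)

section \<open>Taylor coefficients at the origin\<close>

definition taylor_coeff :: "(complex \<Rightarrow> complex) \<Rightarrow> nat \<Rightarrow> complex" where
  "taylor_coeff f k = (deriv ^^ k) f 0 / fact k"

lemma taylor_coeff_const: "taylor_coeff (\<lambda>_. c) k = (if k = 0 then c else 0)"
  by (simp add: taylor_coeff_def)

lemma taylor_coeff_add:
  assumes "f holomorphic_on ball 0 1" "g holomorphic_on ball 0 1"
  shows "taylor_coeff (\<lambda>z. f z + g z) k = taylor_coeff f k + taylor_coeff g k"
  using higher_deriv_add[OF assms, of 0 k] by (simp add: taylor_coeff_def add_divide_distrib)

text \<open>Leibniz's rule divided by \<open>k!\<close>: the factorials absorb the binomial
  coefficients and leave the Cauchy product.\<close>

lemma taylor_coeff_mult: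
  assumes "f holomorphic_on ball 0 1" "g holomorphic_on ball 0 1"
  shows "taylor_coeff (\<lambda>z. f z * g z) k = (\<Sum>i\<le>k. taylor_coeff f i * taylor_coeff g (k - i))"
proof -
  have "of_nat (k choose i) * (deriv ^^ i) f 0 * (deriv ^^ (k - i)) g 0 / fact k
      = taylor_coeff f i * taylor_coeff g (k - i)" if "i \<le> k" for i
    using that by (simp add: taylor_coeff_def binomial_fact)
  then show ?thesis
    using higher_deriv_mult[OF assms, of 0 k]
    by (simp add: taylor_coeff_def sum_divide_distrib atMost_atLeast0)
qed

text \<open>Cauchy's inequality on the circle of radius \<open>s < 1\<close> gives
  \<open>M / s ^ k\<close>, and \<open>s\<close> tends to 1. The bound is the same for all
  \<open>k\<close> and all \<open>f\<close> in the ball, which later allows domination.\<close>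

lemma norm_taylor_coeff_le:
  assumes "f \<in> Hinf_ball M"
  shows "cmod (taylor_coeff f k) \<le> M"
proof -
  have le: "cmod (taylor_coeff f k) \<le> M / s ^ k" if s: "0 < s" "s < 1" for s :: real
  proof -
    have sub: "cball 0 s \<subseteq> ball (0::complex) 1"
      using s by auto
    have hol: "f holomorphic_on cball 0 s"
      using Hinf_ballD(1)[OF assms] sub by (rule holomorphic_on_subset)
    have "cmod ((deriv ^^ k) f 0) \<le> fact k * M / s ^ k"
    proof (rule Cauchy_inequality)
      show "f holomorphic_on ball 0 s"
        using hol by (rule holomorphic_on_subset) auto
      show "continuous_on (cball 0 s) f"
        using hol by (rule holomorphic_on_imp_continuous_on)
    qed (use s assms in \<open>auto simp: Hinf_ball_def\<close>)
    then show ?thesis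
      by (simp add: taylor_coeff_def norm_divide field_simps)
  qed
  have "((\<lambda>s. M / s ^ k) \<longlongrightarrow> M / 1 ^ k) (at_left (1::real))"
    by (intro tendsto_intros) auto
  moreover have "\<forall>\<^sub>F s in at_left (1::real). cmod (taylor_coeff f k) \<le> M / s ^ k"
    by (rule eventually_at_leftI[of 0]) (use le in auto)
  ultimately show ?thesis
    by (intro tendsto_lowerbound[where F = "at_left (1::real)"]) auto
qed

text \<open>By Weierstrass, uniform convergence near 0 carries over to all derivatives at 0. The
  radius 1/2 is an arbitrary choice.\<close>

lemma taylor_coeff_tendsto:
  assumes "uniform_limit (cball 0 (1/2)) F f sequentially"
    and "\<And>n. F n holomorphic_on ball 0 1"
  shows "(\<lambda>n. taylor_coeff (F n) k) \<longlonglongrightarrow> taylor_coeff f k"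
proof -
  have "(\<lambda>n. (deriv ^^ k) (F n) 0) \<longlonglongrightarrow> (deriv ^^ k) f 0"
  proof (rule higher_deriv_complex_uniform_limit)
    show "uniform_limit (ball 0 (1/2)) F f sequentially"
      using assms(1) by (rule uniform_limit_on_subset) auto
    show "\<forall>\<^sub>F n in sequentially. F n holomorphic_on ball 0 (1/2)"
      using assms(2) by (intro always_eventually allI holomorphic_on_subset[OF assms(2)]) auto
  qed auto
  then show ?thesis
    unfolding taylor_coeff_def by (intro tendsto_intros) auto
qed

section \<open>The holomorphic functional calculus\<close>

lemma smult_pow_mat:
  fixes A :: "'a :: comm_semiring_1 mat"
  assumes "A \<in> carrier_mat n n"
  shows "(c \<cdot>\<^sub>m A) ^\<^sub>m k = c ^ k \<cdot>\<^sub>m A ^\<^sub>m k"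
proof (induction k)
  case 0
  show ?case by (rule eq_matI) auto
next
  case (Suc k)
  have [simp]: "A ^\<^sub>m k \<in> carrier_mat n n" "c \<cdot>\<^sub>m A \<in> carrier_mat n n"
    using assms by simp_all
  have "(c \<cdot>\<^sub>m A) ^\<^sub>m Suc k = (c ^ k \<cdot>\<^sub>m A ^\<^sub>m k) * (c \<cdot>\<^sub>m A)"
    by (simp add: Suc.IH)
  also have "\<dots> = c ^ Suc k \<cdot>\<^sub>m (A ^\<^sub>m k * A)"
    using assms by (intro eq_matI) (auto simp: mult_ac)
  finally show ?case by simp
qed

lemma pow_mat_add:
  fixes A :: "'a :: semiring_1 mat"
  assumes A: "A \<in> carrier_mat n n"
  shows "A ^\<^sub>m (k + l) = A ^\<^sub>m k * A ^\<^sub>m l"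
proof (induction l)
  case 0
  show ?case using A by simp
next
  case (Suc l)
  then show ?case
    using assoc_mult_mat[of "A ^\<^sub>m k" n n "A ^\<^sub>m l" n A n] A by simp
qed

lemma spectrum_smult:
  fixes A :: "'a :: field mat"
  assumes "A \<in> carrier_mat n n" "c \<noteq> 0" "k \<in> spectrum (c \<cdot>\<^sub>m A)"
  shows "k / c \<in> spectrum A"
proof -
  obtain v where v: "v \<in> carrier_vec n" "v \<noteq> 0\<^sub>v n" "(c \<cdot>\<^sub>m A) *\<^sub>v v = k \<cdot>\<^sub>v v"
    using assms by (auto simp: spectrum_def eigenvalue_def eigenvector_def)
  have "A *\<^sub>v v = (1 / c) \<cdot>\<^sub>v ((c \<cdot>\<^sub>m A) *\<^sub>v v)"
    using assms v(1) by (intro eq_vecI) auto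
  also have "\<dots> = (k / c) \<cdot>\<^sub>v v"
    unfolding v(3) by (simp add: smult_smult_assoc)
  finally show ?thesis
    using assms v(1,2) by (auto simp: spectrum_def eigenvalue_def eigenvector_def)
qed

locale disc_mat =
  fixes A :: "complex mat" and n :: nat
  assumes carrier: "A \<in> carrier_mat n n" and spectrum: "spectrum A \<subseteq> ball 0 1"
begin

lemmas dims = carrier_matD[OF carrier]

text \<open>Dividing \<open>A\<close> by some \<open>r\<close> strictly between its spectral radius
  and 1 keeps the spectral radius below 1, so the powers of the quotient stay bounded; scaling back
  yields geometric decay.\<close>

lemma pow_bound:
  obtains r C where "0 \<le> r" "r < 1"
    "\<And>k i j. i < n \<Longrightarrow> j < n \<Longrightarrow> cmod ((A ^\<^sub>m k) $$ (i, j)) \<le> C * r ^ k"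
proof (cases "n = 0")
  case True
  \<comment> \<open>An empty matrix has no eigenvalues, so the spectral radius is of no use; the
    bound is vacuous.\<close>
  show ?thesis
    by (rule that[of 0]) (use True in auto)
next
  case False
  define \<rho> where "\<rho> = spectral_radius A"
  have "\<rho> \<in> norm ` spectrum A"
    using spectral_radius_mem_max(1)[OF carrier] False by (simp add: \<rho>_def)
  then have \<rho>: "0 \<le> \<rho>" "\<rho> < 1"
    using spectrum by auto
  define r where "r = (1 + \<rho>) / 2"
  have r: "0 < r" "r < 1" "\<rho> < r"
    using \<rho> by (auto simp: r_def)
  define B where "B = complex_of_real (1 / r) \<cdot>\<^sub>m A"
  have B: "B \<in> carrier_mat n n"
    using carrier by (simp add: B_def)
  have "spectral_radius B \<in> norm ` spectrum B"
    using spectral_radius_mem_max(1)[OF B] False by simp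
  then obtain k where k: "k \<in> spectrum B" "spectral_radius B = cmod k"
    by auto
  have "k / complex_of_real (1 / r) \<in> spectrum A"
    using spectrum_smult[OF carrier, of "complex_of_real (1 / r)" k] k(1) r(1)
    by (simp add: B_def)
  then have "cmod (k / complex_of_real (1 / r)) \<le> \<rho>"
    unfolding \<rho>_def using spectral_radius_mem_max(2)[OF carrier] False by blast
  then have "cmod k * r \<le> \<rho>"
    using r by (simp add: norm_mult)
  then have "cmod k * r < 1 * r"
    using r(3) by linarith
  then have "spectral_radius B < 1"
    unfolding k(2) by (rule iffD1[OF mult_less_cancel_right_pos[OF r(1)]])
  then obtain C where C: "\<And>k. norm_bound (B ^\<^sub>m k) C"
    using spectral_radius_jnf_norm_bound_less_1_upper_triangular[OF B] by blast
  show ?thesis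
  proof (rule that[of r C])
    fix k i j assume ij: "i < n" "j < n"
    have Bk: "B ^\<^sub>m k = complex_of_real (1 / r) ^ k \<cdot>\<^sub>m A ^\<^sub>m k"
      unfolding B_def by (rule smult_pow_mat[OF carrier])
    have "cmod ((B ^\<^sub>m k) $$ (i, j)) \<le> C"
      using C[of k] ij carrier_matD[OF pow_carrier_mat[OF B, of k]]
      unfolding norm_bound_def by metis
    then show "cmod ((A ^\<^sub>m k) $$ (i, j)) \<le> C * r ^ k"
      using ij r(1)
      by (simp add: dims Bk norm_mult norm_power norm_divide power_divide field_simps)
  qed (use r in auto)
qed

lemma hol_calc_carrier [simp]: "hol_calc f A \<in> carrier_mat n n"
  using carrier by (auto simp: hol_calc_def)

lemma hol_calc_dim [simp]: "dim_row (hol_calc f A) = n" "dim_col (hol_calc f A) = n"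
  by (rule carrier_matD[OF hol_calc_carrier])+

lemma hol_calc_index:
  assumes "i < n" "j < n"
  shows "hol_calc f A $$ (i, j) = (\<Sum>k. taylor_coeff f k * (A ^\<^sub>m k) $$ (i, j))"
  using assms carrier by (simp add: hol_calc_def taylor_coeff_def)

text \<open>Bounded coefficients against geometrically decaying powers. Absolute convergence is what
  the Cauchy product in \<open>hol_calc_mult\<close> requires.\<close>

lemma summable_norm_calc:
  assumes "f \<in> Hinf" "i < n" "j < n"
  shows "summable (\<lambda>k. cmod (taylor_coeff f k * (A ^\<^sub>m k) $$ (i, j)))"
proof -
  obtain M where M: "f \<in> Hinf_ball M"
    using assms(1) Hinf_iff_Hinf_ball by blast
  obtain r C where r: "0 \<le> r" "r < 1"
    and C: "\<And>k i j. i < n \<Longrightarrow> j < n \<Longrightarrow> cmod ((A ^\<^sub>m k) $$ (i, j)) \<le> C * r ^ k"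
    using pow_bound by metis
  show ?thesis
  proof (rule summable_comparison_test')
    show "summable (\<lambda>k. M * (C * r ^ k))"
      using r by (intro summable_mult summable_geometric) auto
    show "norm (cmod (taylor_coeff f k * (A ^\<^sub>m k) $$ (i, j))) \<le> M * (C * r ^ k)" for k
      using norm_taylor_coeff_le[OF M] C[OF assms(2,3)] Hinf_ball_nonneg[OF M]
      by (auto simp: norm_mult intro!: mult_mono)
  qed
qed

lemma hol_calc_sums:
  assumes "f \<in> Hinf" "i < n" "j < n"
  shows "(\<lambda>k. taylor_coeff f k * (A ^\<^sub>m k) $$ (i, j)) sums (hol_calc f A $$ (i, j))"
  using summable_norm_cancel[OF summable_norm_calc[OF assms]] assms
  by (simp add: hol_calc_index summable_sums)

lemma hol_calc_const: "hol_calc (\<lambda>_. c) A = c \<cdot>\<^sub>m 1\<^sub>m n"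
proof (rule eq_matI)
  fix i j assume "i < dim_row (c \<cdot>\<^sub>m 1\<^sub>m n)" "j < dim_col (c \<cdot>\<^sub>m 1\<^sub>m n)"
  then have ij: "i < n" "j < n" by auto
  have "(\<lambda>k. taylor_coeff (\<lambda>_. c) k * (A ^\<^sub>m k) $$ (i, j)) sums
      (\<Sum>k\<in>{0}. taylor_coeff (\<lambda>_. c) k * (A ^\<^sub>m k) $$ (i, j))"
    by (rule sums_finite) (auto simp: taylor_coeff_const)
  then show "hol_calc (\<lambda>_. c) A $$ (i, j) = (c \<cdot>\<^sub>m 1\<^sub>m n) $$ (i, j)"
    using sums_unique2[OF hol_calc_sums[OF Hinf_const ij]] ij
    by (simp add: taylor_coeff_const dims)
qed auto

lemma hol_calc_add:
  assumes f: "f \<in> Hinf" and g: "g \<in> Hinf"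
  shows "hol_calc (\<lambda>z. f z + g z) A = hol_calc f A + hol_calc g A"
proof (rule eq_matI)
  fix i j assume "i < dim_row (hol_calc f A + hol_calc g A)" "j < dim_col (hol_calc f A + hol_calc g A)"
  then have ij: "i < n" "j < n" by auto
  have "taylor_coeff (\<lambda>z. f z + g z) k = taylor_coeff f k + taylor_coeff g k" for k
    by (intro taylor_coeff_add Hinf_holomorphic f g)
  then show "hol_calc (\<lambda>z. f z + g z) A $$ (i, j) = (hol_calc f A + hol_calc g A) $$ (i, j)"
    using sums_add[OF hol_calc_sums[OF f ij] hol_calc_sums[OF g ij]]
      hol_calc_sums[OF Hinf_add[OF f g] ij] ij
    by (auto simp: distrib_right intro: sums_unique2)
qed auto

text \<open>Each entry of the matrix product is a finite sum over \<open>l\<close> of products of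
  two absolutely convergent series. Forming Cauchy products and collapsing the sum over
  \<open>l\<close> by \<open>A ^\<^sub>m m * A ^\<^sub>m (k - m) = A ^\<^sub>m k\<close> leaves the
  Taylor coefficients of the product function.\<close>

lemma hol_calc_mult:
  assumes f: "f \<in> Hinf" and g: "g \<in> Hinf"
  shows "hol_calc (\<lambda>z. f z * g z) A = hol_calc f A * hol_calc g A"
proof (rule eq_matI)
  fix i j assume "i < dim_row (hol_calc f A * hol_calc g A)" "j < dim_col (hol_calc f A * hol_calc g A)"
  then have ij: "i < n" "j < n" by auto
  let ?a = "taylor_coeff f" and ?b = "taylor_coeff g"
  have pow: "(A ^\<^sub>m k) $$ (i, j) = (\<Sum>l<n. (A ^\<^sub>m m) $$ (i, l) * (A ^\<^sub>m (k - m)) $$ (l, j))"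
    if "m \<le> k" for m k
  proof -
    have "(A ^\<^sub>m k) $$ (i, j) = (A ^\<^sub>m m * A ^\<^sub>m (k - m)) $$ (i, j)"
      using pow_mat_add[OF carrier, of m "k - m"] that by simp
    also have "\<dots> = (\<Sum>l<n. (A ^\<^sub>m m) $$ (i, l) * (A ^\<^sub>m (k - m)) $$ (l, j))"
      using ij by (simp add: scalar_prod_def atLeast0LessThan dims)
    finally show ?thesis .
  qed
  have term_eq: "(\<Sum>l<n. \<Sum>m\<le>k. (?a m * (A ^\<^sub>m m) $$ (i, l)) * (?b (k - m) * (A ^\<^sub>m (k - m)) $$ (l, j)))
      = taylor_coeff (\<lambda>z. f z * g z) k * (A ^\<^sub>m k) $$ (i, j)" for k
  proof -
    have "(\<Sum>l<n. \<Sum>m\<le>k. (?a m * (A ^\<^sub>m m) $$ (i, l)) * (?b (k - m) * (A ^\<^sub>m (k - m)) $$ (l, j)))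
        = (\<Sum>m\<le>k. ?a m * ?b (k - m) * (\<Sum>l<n. (A ^\<^sub>m m) $$ (i, l) * (A ^\<^sub>m (k - m)) $$ (l, j)))"
      by (subst sum.swap) (simp add: sum_distrib_left mult_ac)
    also have "\<dots> = (\<Sum>m\<le>k. ?a m * ?b (k - m) * (A ^\<^sub>m k) $$ (i, j))"
      by (intro sum.cong refl) (simp add: pow[symmetric])
    finally show ?thesis
      using taylor_coeff_mult[OF Hinf_holomorphic[OF f] Hinf_holomorphic[OF g], of k]
      by (simp add: sum_distrib_right)
  qed
  have "(\<lambda>k. \<Sum>l<n. \<Sum>m\<le>k. (?a m * (A ^\<^sub>m m) $$ (i, l)) * (?b (k - m) * (A ^\<^sub>m (k - m)) $$ (l, j)))
      sums (\<Sum>l<n. hol_calc f A $$ (i, l) * hol_calc g A $$ (l, j))"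
  proof (rule sums_sum)
    fix l assume "l \<in> {..<n}"
    then have l: "l < n" by simp
    show "(\<lambda>k. \<Sum>m\<le>k. (?a m * (A ^\<^sub>m m) $$ (i, l)) * (?b (k - m) * (A ^\<^sub>m (k - m)) $$ (l, j)))
        sums (hol_calc f A $$ (i, l) * hol_calc g A $$ (l, j))"
      unfolding hol_calc_index[OF ij(1) l] hol_calc_index[OF l ij(2)]
      by (rule Cauchy_product_sums) (intro summable_norm_calc f g ij l)+
  qed
  then have "(\<lambda>k. taylor_coeff (\<lambda>z. f z * g z) k * (A ^\<^sub>m k) $$ (i, j))
      sums (\<Sum>l<n. hol_calc f A $$ (i, l) * hol_calc g A $$ (l, j))"
    by (simp only: term_eq)
  then have "hol_calc (\<lambda>z. f z * g z) A $$ (i, j)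
      = (\<Sum>l<n. hol_calc f A $$ (i, l) * hol_calc g A $$ (l, j))"
    using hol_calc_sums[OF Hinf_mult[OF f g] ij] by (rule sums_unique2[symmetric])
  then show "hol_calc (\<lambda>z. f z * g z) A $$ (i, j) = (hol_calc f A * hol_calc g A) $$ (i, j)"
    using ij by (simp add: scalar_prod_def atLeast0LessThan)
qed auto

text \<open>Linearity, in the form needed for functions that act on \<open>A\<close> as scalars; a
  scalar factor is treated as multiplication by a constant function.\<close>

lemma hol_calc_scalar_sum:
  assumes "finite S" "\<And>j. j \<in> S \<Longrightarrow> F j \<in> Hinf"
    and "\<And>j. j \<in> S \<Longrightarrow> hol_calc (F j) A = c j \<cdot>\<^sub>m 1\<^sub>m n"
  shows "hol_calc (\<lambda>z. \<Sum>j\<in>S. a j * F j z) A = (\<Sum>j\<in>S. a j * c j) \<cdot>\<^sub>m 1\<^sub>m n"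
  using assms
proof (induction S rule: finite_induct)
  case empty
  show ?case by (simp add: hol_calc_const)
next
  case (insert x S)
  have *: "hol_calc (\<lambda>z. a x * F x z) A = (a x * c x) \<cdot>\<^sub>m 1\<^sub>m n"
    using hol_calc_mult[OF Hinf_const, of "F x" "a x"] insert.prems
    by (simp add: hol_calc_const) (auto intro!: eq_matI)
  have "(\<lambda>z. \<Sum>j\<in>S. a j * F j z) \<in> Hinf"
    using insert.prems by (intro Hinf_sum Hinf_mult Hinf_const) auto
  then have "hol_calc (\<lambda>z. a x * F x z + (\<Sum>j\<in>S. a j * F j z)) A
      = (a x * c x) \<cdot>\<^sub>m 1\<^sub>m n + (\<Sum>j\<in>S. a j * c j) \<cdot>\<^sub>m 1\<^sub>m n"
    using insert by (subst hol_calc_add) (auto simp: *)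
  then show ?case
    using insert.hyps by (simp add: add_smult_distrib_right_mat[of _ n n, symmetric])
qed

text \<open>Tannery's theorem: the terms converge one by one, and \<open>M * (C * r ^ k)\<close>
  dominates them uniformly in \<open>m\<close>. Because the common bound \<open>M\<close> controls
  the tails, convergence near 0 is enough.\<close>

lemma hol_calc_tendsto:
  assumes F: "\<And>m. F m \<in> Hinf_ball M"
    and lim: "uniform_limit (cball 0 (1/2)) F f sequentially"
    and ij: "i < n" "j < n"
  shows "(\<lambda>m. hol_calc (F m) A $$ (i, j)) \<longlonglongrightarrow> hol_calc f A $$ (i, j)"
proof -
  obtain r C where r: "0 \<le> r" "r < 1"
    and C: "\<And>k i j. i < n \<Longrightarrow> j < n \<Longrightarrow> cmod ((A ^\<^sub>m k) $$ (i, j)) \<le> C * r ^ k"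
    using pow_bound by metis
  have bound: "cmod (taylor_coeff (F m) k * (A ^\<^sub>m k) $$ (i, j)) \<le> M * (C * r ^ k)" for k m
    using norm_taylor_coeff_le[OF F] C[OF ij] Hinf_ball_nonneg[OF F]
    by (auto simp: norm_mult intro!: mult_mono)
  have summable: "summable (\<lambda>k. M * (C * r ^ k))"
    using r by (intro summable_mult summable_geometric) auto
  have lim_coeff: "(\<lambda>m. taylor_coeff (F m) k * (A ^\<^sub>m k) $$ (i, j))
      \<longlonglongrightarrow> taylor_coeff f k * (A ^\<^sub>m k) $$ (i, j)" for k
    by (intro tendsto_intros taylor_coeff_tendsto lim Hinf_ballD(1)[OF F])
  have "\<forall>\<^sub>F (k, m) in at_top \<times>\<^sub>F sequentially.
      cmod (taylor_coeff (F m) k * (A ^\<^sub>m k) $$ (i, j)) \<le> M * (C * r ^ k)"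
    using bound by (intro always_eventually) auto
  from tannerys_theorem[THEN conjunct2, THEN conjunct2, OF _ this summable] lim_coeff
  show ?thesis
    unfolding hol_calc_index[OF ij] by simp
qed

text \<open>Transfers interpolation conditions to the limit function, even if each of them holds
  only from some index on.\<close>

lemma hol_calc_limit_eqI:
  assumes "\<And>m. F m \<in> Hinf_ball M" "uniform_limit (cball 0 (1/2)) F f sequentially"
    and "\<forall>\<^sub>F m in sequentially. hol_calc (F m) A = B"
  shows "hol_calc f A = B"
proof -
  have "dim_row B = n" "dim_col B = n"
    using assms(3) by (auto simp: eventually_sequentially)
  moreover have "hol_calc f A $$ (i, j) = B $$ (i, j)" if "i < n" "j < n" for i j
  proof (rule LIMSEQ_unique)
    show "(\<lambda>m. hol_calc (F m) A $$ (i, j)) \<longlonglongrightarrow> hol_calc f A $$ (i, j)"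
      using assms(1,2) that by (rule hol_calc_tendsto)
    show "(\<lambda>m. hol_calc (F m) A $$ (i, j)) \<longlonglongrightarrow> B $$ (i, j)"
      by (rule tendsto_eventually) (use assms(3) in eventually_elim, simp)
  qed
  ultimately show ?thesis
    by (intro eq_matI) auto
qed

end

section \<open>The interpolation constant\<close>

text \<open>Two modes of convergence are recorded: pointwise on the disc, for estimates of sums of
  moduli, and uniform near 0, for the functional calculus.\<close>

lemma Hinf_ball_Montel:
  assumes F: "\<And>m. F m \<in> Hinf_ball M"
  obtains f s where "f \<in> Hinf_ball M" "strict_mono (s :: nat \<Rightarrow> nat)"
    "\<And>z. cmod z < 1 \<Longrightarrow> (\<lambda>m. F (s m) z) \<longlonglongrightarrow> f z"
    "uniform_limit (cball 0 (1/2)) (F \<circ> s) f sequentially"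
proof -
  obtain f s where fs: "f holomorphic_on ball 0 1" "strict_mono (s :: nat \<Rightarrow> nat)"
    "\<And>z. z \<in> ball 0 1 \<Longrightarrow> (\<lambda>m. F (s m) z) \<longlonglongrightarrow> f z"
    "\<And>K. compact K \<Longrightarrow> K \<subseteq> ball 0 1 \<Longrightarrow> uniform_limit K (F \<circ> s) f sequentially"
  proof (rule Montel[of "ball 0 1" "Hinf_ball M" F])
    show "range F \<subseteq> Hinf_ball M"
      using F by blast
    show "\<exists>B. \<forall>h\<in>Hinf_ball M. \<forall>z\<in>K. cmod (h z) \<le> B" if "K \<subseteq> ball 0 1" for K
      using that by (intro exI[of _ M]) (auto simp: Hinf_ball_def)
  qed (auto simp: Hinf_ball_def)
  show ?thesis
  proof (rule that[of f s])
    have "cmod (f z) \<le> M" if "z \<in> ball 0 1" for z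
      by (rule Lim_norm_ubound[OF _ fs(3)[OF that]])
        (use F that in \<open>auto simp: Hinf_ball_def intro!: always_eventually\<close>)
    then show "f \<in> Hinf_ball M"
      using fs(1) by (auto simp: Hinf_ball_def)
    show "uniform_limit (cball 0 (1/2)) (F \<circ> s) f sequentially"
      by (rule fs(4)) auto
  qed (use fs in auto)
qed

text \<open>
  The Baire category theorem in a product of discrete spaces, whose basic open sets consist of all
  sequences with a given finite prefix. The discrete topology on \<open>S\<close> makes the sets \<open>E M\<close> easier to
  recognise as closed, while the weaker conclusion still suffices below: finitely many coordinates
  can be corrected by hand.
\<close>

lemma prefix_Baire:
  fixes E :: "nat \<Rightarrow> (nat \<Rightarrow> 'a) set" and S :: "'a set"
  assumes closed: "\<And>M x. (\<And>K. \<exists>y\<in>E M. \<forall>k<K. y k = x k) \<Longrightarrow> x \<in> E M"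
    and cover: "\<And>x. range x \<subseteq> S \<Longrightarrow> \<exists>M. x \<in> E M"
    and ne: "S \<noteq> {}"
  obtains M x K where "range x \<subseteq> S"
    "\<And>y. range y \<subseteq> S \<Longrightarrow> (\<And>k. k < K \<Longrightarrow> y k = x k) \<Longrightarrow> y \<in> E M"
proof (rule ccontr)
  note result = that
  assume none: "\<not> thesis"
  have neg: "\<exists>y. range y \<subseteq> S \<and> (\<forall>k<K. y k = x k) \<and> y \<notin> E M" if "range x \<subseteq> S" for M x K
    using none result[of x K M] that by blast
  \<comment> \<open>Under the negated conclusion every prefix extends to some \<open>y\<close>
    outside \<open>E M\<close>; closedness then gives a length \<open>L\<close> at which the prefix
    of \<open>y\<close> already excludes all of \<open>E M\<close>.\<close>
  have step: "\<exists>y L. range y \<subseteq> S \<and> K < L \<and> (\<forall>k<K. y k = x k) \<and> (\<forall>z\<in>E M. \<exists>k<L. z k \<noteq> y k)"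
    if "range x \<subseteq> S" for M x K
  proof -
    obtain y where y: "range y \<subseteq> S" "\<forall>k<K. y k = x k" "y \<notin> E M"
      using neg[OF \<open>range x \<subseteq> S\<close>] by blast
    obtain L where "\<forall>z\<in>E M. \<exists>k<L. z k \<noteq> y k"
      using closed[of M y] y(3) by blast
    then have "\<forall>z\<in>E M. \<exists>k<max L (Suc K). z k \<noteq> y k"
      by (meson less_max_iff_disj)
    then show ?thesis
      using y(1,2) by (intro exI[of _ y] exI[of _ "max L (Suc K)"]) auto
  qed
  obtain s0 where "s0 \<in> S" using ne by blast
  \<comment> \<open>Nested prefixes, stored as a sequence with the length of its relevant part;
    stage \<open>m\<close> moves away from \<open>E m\<close>.\<close>
  obtain X :: "nat \<Rightarrow> (nat \<Rightarrow> 'a) \<times> nat" where X: "\<And>m. range (fst (X m)) \<subseteq> S"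
    "\<And>m. snd (X m) < snd (X (Suc m)) \<and> (\<forall>k<snd (X m). fst (X (Suc m)) k = fst (X m) k)
       \<and> (\<forall>z\<in>E m. \<exists>k<snd (X (Suc m)). z k \<noteq> fst (X (Suc m)) k)"
  proof -
    have "\<exists>X. \<forall>m. range (fst (X m)) \<subseteq> S \<and>
        (snd (X m) < snd (X (Suc m)) \<and> (\<forall>k<snd (X m). fst (X (Suc m)) k = fst (X m) k)
       \<and> (\<forall>z\<in>E m. \<exists>k<snd (X (Suc m)). z k \<noteq> fst (X (Suc m)) k))"
    proof (rule dependent_nat_choice[of "\<lambda>_ p. range (fst p) \<subseteq> S"
          "\<lambda>m p q. snd p < snd q \<and> (\<forall>k<snd p. fst q k = fst p k)
            \<and> (\<forall>z\<in>E m. \<exists>k<snd q. z k \<noteq> fst q k)"])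
      show "\<exists>p :: (nat \<Rightarrow> 'a) \<times> nat. range (fst p) \<subseteq> S"
        using \<open>s0 \<in> S\<close> by (intro exI[of _ "(\<lambda>_. s0, 0)"]) auto
      show "\<exists>q. range (fst q) \<subseteq> S \<and> snd p < snd q \<and> (\<forall>k<snd p. fst q k = fst p k)
          \<and> (\<forall>z\<in>E m. \<exists>k<snd q. z k \<noteq> fst q k)"
        if "range (fst p) \<subseteq> S" for p :: "(nat \<Rightarrow> 'a) \<times> nat" and m
        using step[OF that, of "snd p" m] by auto
    qed
    then obtain X :: "nat \<Rightarrow> (nat \<Rightarrow> 'a) \<times> nat" where X: "\<forall>m. range (fst (X m)) \<subseteq> S \<and>
        (snd (X m) < snd (X (Suc m)) \<and> (\<forall>k<snd (X m). fst (X (Suc m)) k = fst (X m) k)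
       \<and> (\<forall>z\<in>E m. \<exists>k<snd (X (Suc m)). z k \<noteq> fst (X (Suc m)) k))" ..
    show thesis
      by (rule that[of X]) (rule X[rule_format, THEN conjunct1] X[rule_format, THEN conjunct2])+
  qed
  have len: "m \<le> snd (X m)" for m
  proof (induction m)
    case (Suc m)
    then show ?case using X(2)[of m] by linarith
  qed simp
  have stable: "fst (X (m + d)) k = fst (X m) k" if "k < snd (X m)" for m d k
  proof (induction d)
    case (Suc d)
    have "snd (X m) \<le> snd (X (m + d))"
      by (rule lift_Suc_mono_le[of "\<lambda>m. snd (X m)"]) (use X(2) in \<open>auto simp: less_imp_le\<close>)
    then show ?case using Suc X(2)[of "m + d"] that by auto
  qed simp
  \<comment> \<open>Stage \<open>Suc k\<close> is late enough: by \<open>len\<close> its prefix has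
    length at least \<open>Suc k\<close>, so coordinate \<open>k\<close> is already frozen.\<close>
  define x where "x k = fst (X (Suc k)) k" for k
  have x: "x k = fst (X m) k" if "k < snd (X m)" for m k
  proof (cases "m \<le> Suc k")
    case True
    then show ?thesis
      using stable[OF that, of "Suc k - m"] by (simp add: x_def)
  next
    case False
    have "k < snd (X (Suc k))"
      using len[of "Suc k"] by simp
    then show ?thesis
      using stable[of k "Suc k" "m - Suc k"] False by (simp add: x_def)
  qed
  have "range x \<subseteq> S"
    using X(1) by (auto simp: x_def)
  then obtain M where "x \<in> E M"
    using cover by blast
  then obtain k where "k < snd (X (Suc M))" "x k \<noteq> fst (X (Suc M)) k"
    using X(2)[of M] by blast
  then show False
    using x by blast
qed

section \<open>Scalar interpolation with a uniform bound\<close>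

locale disc_mats =
  fixes A :: "nat \<Rightarrow> complex mat"
  assumes disc_mat: "\<And>k. disc_mat (A k) (dim_row (A k))"
begin

text \<open>The targets are scalar matrices, the values of constant functions, so the data are plain
  sequences of numbers to which \<open>prefix_Baire\<close> applies.\<close>

definition interpolable :: "real \<Rightarrow> (nat \<Rightarrow> complex) \<Rightarrow> bool" where
  "interpolable M x \<longleftrightarrow>
     (\<exists>f\<in>Hinf_ball M. \<forall>k. hol_calc f (A k) = x k \<cdot>\<^sub>m 1\<^sub>m (dim_row (A k)))"

lemma interpolable_mono: "interpolable M x \<Longrightarrow> M \<le> N \<Longrightarrow> interpolable N x"
  unfolding interpolable_def Hinf_ball_def by fastforce

lemma interpolable_sum:
  assumes "finite S" "\<And>j. j \<in> S \<Longrightarrow> interpolable (M j) (x j)"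
  shows "interpolable (\<Sum>j\<in>S. cmod (c j) * M j) (\<lambda>k. \<Sum>j\<in>S. c j * x j k)"
proof -
  obtain F where F: "\<And>j. j \<in> S \<Longrightarrow> F j \<in> Hinf_ball (M j)"
    "\<And>j k. j \<in> S \<Longrightarrow> hol_calc (F j) (A k) = x j k \<cdot>\<^sub>m 1\<^sub>m (dim_row (A k))"
    using assms(2) unfolding interpolable_def by metis
  show ?thesis
    unfolding interpolable_def
  proof (intro bexI allI)
    show "(\<lambda>z. \<Sum>j\<in>S. c j * F j z) \<in> Hinf_ball (\<Sum>j\<in>S. cmod (c j) * M j)"
      by (intro Hinf_ball_sum Hinf_ball_mult Hinf_ball_const F)
    show "hol_calc (\<lambda>z. \<Sum>j\<in>S. c j * F j z) (A k)
        = (\<Sum>j\<in>S. c j * x j k) \<cdot>\<^sub>m 1\<^sub>m (dim_row (A k))" for k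
      using assms(1) F Hinf_iff_Hinf_ball
      by (intro disc_mat.hol_calc_scalar_sum[OF disc_mat]) blast+
  qed
qed

text \<open>Solutions matching ever longer prefixes of \<open>x\<close> form a normal family, and a
  subsequential limit solves the whole problem. This is the closedness demanded by
  \<open>prefix_Baire\<close>.\<close>

lemma interpolable_closed:
  assumes "\<And>K. \<exists>y. interpolable M y \<and> (\<forall>k<K. y k = x k)"
  shows "interpolable M x"
proof -
  have "\<exists>f\<in>Hinf_ball M. \<forall>k<K. hol_calc f (A k) = x k \<cdot>\<^sub>m 1\<^sub>m (dim_row (A k))" for K
    using assms[of K] unfolding interpolable_def by metis
  then obtain F where F: "\<And>K. F K \<in> Hinf_ball M"
    "\<And>K k. k < K \<Longrightarrow> hol_calc (F K) (A k) = x k \<cdot>\<^sub>m 1\<^sub>m (dim_row (A k))"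
    by metis
  obtain f s where f: "f \<in> Hinf_ball M" "strict_mono (s :: nat \<Rightarrow> nat)"
    "uniform_limit (cball 0 (1/2)) (F \<circ> s) f sequentially"
    using Hinf_ball_Montel[of F M] F(1) by metis
  have "hol_calc f (A k) = x k \<cdot>\<^sub>m 1\<^sub>m (dim_row (A k))" for k
  proof (rule disc_mat.hol_calc_limit_eqI[OF disc_mat _ f(3), where M = M])
    show "\<forall>\<^sub>F m in sequentially. hol_calc ((F \<circ> s) m) (A k) = x k \<cdot>\<^sub>m 1\<^sub>m (dim_row (A k))"
      using eventually_gt_at_top[of k]
    proof eventually_elim
      case (elim m)
      then have "k < s m"
        using seq_suble[OF f(2), of m] by linarith
      then show ?case by (simp add: F(2))
    qed
  qed (simp add: F(1))
  then show ?thesis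
    using f(1) by (auto simp: interpolable_def)
qed

text \<open>Baire yields one bound \<open>M\<close> for all data with a certain prefix of length
  \<open>K\<close>. Differences of such data cover everything that vanishes before \<open>K\<close>,
  and the first \<open>K\<close> coordinates cost at most the sum of the bounds for unit
  vectors.\<close>

lemma interpolation_constant:
  assumes interp: "\<And>x. range x \<subseteq> cball 0 1 \<Longrightarrow> \<exists>M. interpolable M x"
  obtains C where "\<And>x. range x \<subseteq> cball 0 1 \<Longrightarrow> interpolable C x"
proof -
  obtain M x0 K where x0: "range x0 \<subseteq> cball (0::complex) 1" and
    M: "\<And>y. range y \<subseteq> cball 0 1 \<Longrightarrow> (\<And>k. k < K \<Longrightarrow> y k = x0 k) \<Longrightarrow> interpolable (real M) y"
  proof (rule prefix_Baire[of "\<lambda>M. {x. interpolable (real M) x}" "cball 0 1"])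
    show "\<exists>M. x \<in> {x. interpolable (real M) x}" if "range x \<subseteq> cball 0 1" for x
      using interp[OF that] interpolable_mono real_nat_ceiling_ge by blast
  qed (auto intro: interpolable_closed)
  \<comment> \<open>The bounds may grow with \<open>j\<close>, since just the first \<open>K\<close>
    of them enter the constant.\<close>
  have "\<exists>B. interpolable B (\<lambda>k. if k = j then 1 else 0)" for j :: nat
    by (rule interp) auto
  then obtain B where B: "\<And>j. interpolable (B j) (\<lambda>k. if k = j then 1 else 0)"
    by metis
  have B0: "0 \<le> B j" for j
    using B[of j] Hinf_ball_nonneg by (auto simp: interpolable_def)
  have "interpolable (real M + real M + (\<Sum>j<K. B j)) x" if x: "range x \<subseteq> cball 0 1" for x
  proof -
    \<comment> \<open>The difference of two members of the prefix class is \<open>x\<close> from \<open>K\<close> on and \<open>0\<close> before.\<close>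
    define X where "X j = (if j < K then (\<lambda>k. if k = j then 1 else 0)
      else if j = K then (\<lambda>k. if k < K then x0 k else x k)
      else (\<lambda>k. if k < K then x0 k else 0))" for j
    define N where "N j = (if j < K then B j else real M)" for j
    define c where "c j = (if j < K then x j else if j = K then 1 else -1)" for j
    \<comment> \<open>The \<open>K + 2\<close> summands are \<open>K\<close> unit vectors and the
      two members of the prefix class, taken with coefficients 1 and -1.\<close>
    have "interpolable (\<Sum>j<Suc (Suc K). cmod (c j) * N j) (\<lambda>k. \<Sum>j<Suc (Suc K). c j * X j k)"
    proof (rule interpolable_sum)
      show "interpolable (N j) (X j)" for j
        using x0 x by (auto simp: X_def N_def B image_subset_iff intro!: M)
    qed auto
    moreover have "(\<lambda>k. \<Sum>j<Suc (Suc K). c j * X j k) = x"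
    proof
      fix k
      have "(\<Sum>j<K. c j * X j k) = (\<Sum>j<K. if j = k then x k else 0)"
        by (rule sum.cong) (auto simp: c_def X_def)
      then show "(\<Sum>j<Suc (Suc K). c j * X j k) = x k"
        by (simp add: c_def X_def)
    qed
    moreover have "(\<Sum>j<Suc (Suc K). cmod (c j) * N j) \<le> real M + real M + (\<Sum>j<K. B j)"
    proof -
      have "(\<Sum>j<K. cmod (c j) * N j) \<le> (\<Sum>j<K. B j)"
        using x B0 by (intro sum_mono) (auto simp: c_def N_def image_subset_iff intro!: mult_left_le_one_le)
      then show ?thesis
        by (simp add: c_def N_def)
    qed
    ultimately show ?thesis
      by (metis interpolable_mono)
  qed
  then show ?thesis by (rule that)
qed

end

section \<open>Averaging over roots of unity\<close>

text \<open>Orthogonality of characters: with \<open>x\<close> equal to \<omega> to the power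
  \<open>l - k\<close>, a geometric sum over a full period vanishes unless \<open>x = 1\<close>.
  Primitivity of \<omega> is expressed as injectivity of its powers.\<close>

lemma sum_roots_of_unity:
  fixes \<omega> :: complex
  assumes "cmod \<omega> = 1" "\<omega> ^ N = 1" "inj_on (\<lambda>k. \<omega> ^ k) {..<N}" "k < N" "l < N"
  shows "(\<Sum>j<N. cnj (\<omega> ^ (j * k)) * \<omega> ^ (j * l)) = (if k = l then of_nat N else 0)"
proof -
  define x where "x = cnj (\<omega> ^ k) * \<omega> ^ l"
  have unit: "\<omega> ^ k * cnj (\<omega> ^ k) = 1" for k
    using complex_norm_square[of "\<omega> ^ k"] assms(1) by (simp add: norm_power)
  have eq: "cnj (\<omega> ^ (j * k)) * \<omega> ^ (j * l) = x ^ j" for j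
    by (simp add: x_def power_mult_distrib power_mult[symmetric] mult.commute)
  show ?thesis
  proof (cases "k = l")
    case True
    then have "x = 1"
      using unit[of k] by (simp add: x_def mult.commute)
    then show ?thesis
      unfolding eq using True by simp
  next
    case False
    have "x \<noteq> 1"
    proof
      assume "x = 1"
      then have "\<omega> ^ k = \<omega> ^ k * cnj (\<omega> ^ k) * \<omega> ^ l"
        by (simp add: x_def mult.assoc)
      then have "\<omega> ^ k = \<omega> ^ l"
        by (simp only: unit) simp
      then show False
        using inj_onD[OF assms(3)] assms(4,5) False by auto
    qed
    moreover have "x ^ N = 1"
      unfolding x_def power_mult_distrib
      by (simp add: power_mult[symmetric] mult.commute[of _ N])
        (simp add: power_mult assms(2) flip: complex_cnj_power)
    ultimately show ?thesis
      unfolding eq using False geometric_sum[of x N] by simp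
  qed
qed

text \<open>Expand the squared moduli and move the sum over \<open>k\<close> inside, where
  orthogonality removes the off-diagonal terms.\<close>

lemma root_of_unity_Parseval:
  fixes \<omega> :: complex
  assumes "cmod \<omega> = 1" "\<omega> ^ N = 1" "inj_on (\<lambda>k. \<omega> ^ k) {..<N}"
  shows "(\<Sum>k<N. (cmod (\<Sum>j<N. cnj (\<omega> ^ (j * k)) * x j))\<^sup>2) = real N * (\<Sum>j<N. (cmod (x j))\<^sup>2)"
proof -
  have "complex_of_real (\<Sum>k<N. (cmod (\<Sum>j<N. cnj (\<omega> ^ (j * k)) * x j))\<^sup>2)
      = (\<Sum>k<N. (\<Sum>j<N. cnj (\<omega> ^ (j * k)) * x j) * (\<Sum>i<N. \<omega> ^ (i * k) * cnj (x i)))"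
    by (simp only: of_real_sum complex_norm_square cnj_sum complex_cnj_mult complex_cnj_cnj)
  also have "\<dots> = (\<Sum>k<N. \<Sum>j<N. \<Sum>i<N. x j * cnj (x i) * (cnj (\<omega> ^ (k * j)) * \<omega> ^ (k * i)))"
    by (simp add: sum_product mult_ac)
  also have "\<dots> = (\<Sum>j<N. \<Sum>k<N. \<Sum>i<N. x j * cnj (x i) * (cnj (\<omega> ^ (k * j)) * \<omega> ^ (k * i)))"
    by (rule sum.swap)
  also have "\<dots> = (\<Sum>j<N. \<Sum>i<N. \<Sum>k<N. x j * cnj (x i) * (cnj (\<omega> ^ (k * j)) * \<omega> ^ (k * i)))"
    by (intro sum.cong refl sum.swap)
  also have "\<dots> = (\<Sum>j<N. \<Sum>i<N. x j * cnj (x i) * (if j = i then of_nat N else 0))"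
    by (simp only: sum_distrib_left[symmetric])
      (intro sum.cong refl arg_cong2[where f = "(*)"] sum_roots_of_unity assms; simp)
  also have "\<dots> = complex_of_real (real N * (\<Sum>j<N. (cmod (x j))\<^sup>2))"
    by (simp add: if_distrib[of "(*) _"] sum_distrib_left mult_ac cong: if_cong flip: complex_norm_square)
  finally show ?thesis
    by (simp only: of_real_eq_iff)
qed

lemma primitive_root_of_unity:
  assumes "N > 0"
  obtains \<omega> :: complex where "cmod \<omega> = 1" "\<omega> ^ N = 1" "inj_on (\<lambda>k. \<omega> ^ k) {..<N}"
proof
  define \<omega> where "\<omega> = cis (2 * pi / N)"
  show "cmod \<omega> = 1" by (simp add: \<omega>_def)
  show "\<omega> ^ N = 1" unfolding \<omega>_def Complex.DeMoivre using assms by simp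
  have pow: "\<omega> ^ k = exp (2 * of_real pi * \<i> * of_nat k / of_nat N)" for k
    by (simp add: \<omega>_def cis_conv_exp exp_of_nat_mult[symmetric] mult_ac)
  show "inj_on (\<lambda>k. \<omega> ^ k) {..<N}"
    using assms by (auto simp: inj_on_def pow complex_root_unity_eq cong_def)
qed

section \<open>Dual functions for finitely many matrices, then for all\<close>

context disc_mats
begin

text \<open>The discrete Fourier transform of the \<open>F j\<close> has square sum at most
  \<open>C\<^sup>2\<close> by Parseval. Squaring turns this into a bound on the sum of moduli and
  keeps the interpolated values, because 0 and 1 are idempotent. The bound does not depend on
  \<open>N\<close>.\<close>

lemma finite_Beurling:
  assumes C: "\<And>x. range x \<subseteq> cball 0 1 \<Longrightarrow> interpolable C x"
  obtains f where "\<And>k. f k \<in> Hinf_ball (C\<^sup>2)"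
    "\<And>K z. cmod z < 1 \<Longrightarrow> (\<Sum>k<K. cmod (f k z)) \<le> C\<^sup>2"
    "\<And>k l. k < N \<Longrightarrow> l < N \<Longrightarrow>
       hol_calc (f k) (A l) = (if k = l then 1 else 0) \<cdot>\<^sub>m 1\<^sub>m (dim_row (A l))"
proof (cases "N = 0")
  case True
  show ?thesis
    by (rule that[of "\<lambda>_ _. 0"]) (use True in \<open>auto simp: Hinf_ball_def\<close>)
next
  case False
  obtain \<omega> :: complex where \<omega>: "cmod \<omega> = 1" "\<omega> ^ N = 1" "inj_on (\<lambda>k. \<omega> ^ k) {..<N}"
    using primitive_root_of_unity False by blast
  have "interpolable C (\<lambda>k. \<omega> ^ (j * k))" for j
    by (rule C) (auto simp: norm_power \<omega>(1))
  then obtain F where F: "\<And>j. F j \<in> Hinf_ball C"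
    "\<And>j k. hol_calc (F j) (A k) = \<omega> ^ (j * k) \<cdot>\<^sub>m 1\<^sub>m (dim_row (A k))"
    unfolding interpolable_def by metis
  then have F': "F j \<in> Hinf" for j
    using Hinf_iff_Hinf_ball by blast
  define g where "g k z = (\<Sum>j<N. (cnj (\<omega> ^ (j * k)) / of_nat N) * F j z)" for k z
  have g: "g k \<in> Hinf" for k
    unfolding g_def by (intro Hinf_sum Hinf_mult Hinf_const F')
  have g_calc: "hol_calc (g k) (A l) = (if k = l then 1 else 0) \<cdot>\<^sub>m 1\<^sub>m (dim_row (A l))"
    if "k < N" "l < N" for k l
  proof -
    have "hol_calc (g k) (A l)
        = (\<Sum>j<N. (cnj (\<omega> ^ (j * k)) / of_nat N) * \<omega> ^ (j * l)) \<cdot>\<^sub>m 1\<^sub>m (dim_row (A l))"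
      unfolding g_def by (rule disc_mat.hol_calc_scalar_sum[OF disc_mat]) (auto simp: F' F(2))
    also have "(\<Sum>j<N. (cnj (\<omega> ^ (j * k)) / of_nat N) * \<omega> ^ (j * l)) = (if k = l then 1 else 0)"
      using sum_roots_of_unity[OF \<omega> that] False by (simp add: sum_divide_distrib[symmetric])
    finally show ?thesis .
  qed
  have bound: "(\<Sum>k<N. cmod (g k z * g k z)) \<le> C\<^sup>2" if z: "cmod z < 1" for z
  proof -
    have g_eq: "g k z = (\<Sum>j<N. cnj (\<omega> ^ (j * k)) * F j z) / of_nat N" for k
      by (simp add: g_def sum_divide_distrib)
    have "(\<Sum>k<N. cmod (g k z * g k z)) = (\<Sum>k<N. (cmod (\<Sum>j<N. cnj (\<omega> ^ (j * k)) * F j z))\<^sup>2) / (real N)\<^sup>2"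
      by (simp add: g_eq norm_mult norm_divide power2_eq_square flip: sum_divide_distrib)
    \<comment> \<open>Parseval contributes a factor \<open>N\<close>, which cancels one of the two
      in the denominator.\<close>
    also have "\<dots> = (\<Sum>j<N. (cmod (F j z))\<^sup>2) / real N"
      unfolding root_of_unity_Parseval[OF \<omega>] using False by (simp add: power2_eq_square)
    also have "\<dots> \<le> (\<Sum>j<N. C\<^sup>2) / real N"
      using z F(1) by (intro divide_right_mono sum_mono power_mono Hinf_ballD(2)) auto
    also have "\<dots> = C\<^sup>2"
      using False by simp
    finally show ?thesis .
  qed
  \<comment> \<open>Extension by zero makes the estimate hold for partial sums of any length
    \<open>K\<close>.\<close>
  define f where "f k z = (if k < N then g k z * g k z else 0)" for k z
  have sum: "(\<Sum>k<K. cmod (f k z)) \<le> C\<^sup>2" if "cmod z < 1" for K z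
  proof -
    have "(\<Sum>k<K. cmod (f k z)) = (\<Sum>k\<in>{..<K} \<inter> {..<N}. cmod (f k z))"
      by (rule sum.mono_neutral_right) (auto simp: f_def)
    also have "\<dots> \<le> (\<Sum>k<N. cmod (f k z))"
      by (rule sum_mono2) auto
    also have "\<dots> = (\<Sum>k<N. cmod (g k z * g k z))"
      by (simp add: f_def)
    finally show ?thesis
      using bound[OF that] by linarith
  qed
  show ?thesis
  proof (rule that[of f])
    fix k
    have "cmod (f k z) \<le> C\<^sup>2" if "cmod z < 1" for z
      using sum[OF that, of "Suc k"] sum_nonneg[of "{..<k}" "\<lambda>k. cmod (f k z)"] by simp
    moreover have "f k holomorphic_on ball 0 1"
      using Hinf_holomorphic[OF g[of k]] by (cases "k < N") (auto simp: f_def[abs_def] intro!: holomorphic_intros)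
    ultimately show "f k \<in> Hinf_ball (C\<^sup>2)"
      by (auto simp: Hinf_ball_def)
  next
    fix k l assume kl: "k < N" "l < N"
    then have "hol_calc (f k) (A l) = hol_calc (g k) (A l) * hol_calc (g k) (A l)"
      using disc_mat.hol_calc_mult[OF disc_mat g g, of k k l] by (simp add: f_def[abs_def])
    then show "hol_calc (f k) (A l) = (if k = l then 1 else 0) \<cdot>\<^sub>m 1\<^sub>m (dim_row (A l))"
      using kl by (auto simp: g_calc)
  qed (rule sum)
qed

text \<open>The bounds for the finite systems are uniform in \<open>N\<close>, so a diagonal
  subsequence converges for every \<open>k\<close> at once; bounds on partial sums and interpolation
  conditions survive the limit.\<close>

lemma Beurling:
  assumes C: "\<And>x. range x \<subseteq> cball 0 1 \<Longrightarrow> interpolable C x"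
  obtains f where "\<And>k. f k \<in> Hinf_ball (C\<^sup>2)"
    "\<And>K z. cmod z < 1 \<Longrightarrow> (\<Sum>k<K. cmod (f k z)) \<le> C\<^sup>2"
    "\<And>k l. hol_calc (f k) (A l) = (if k = l then 1 else 0) \<cdot>\<^sub>m 1\<^sub>m (dim_row (A l))"
proof -
  define good where "good N f \<longleftrightarrow> (\<forall>k. f k \<in> Hinf_ball (C\<^sup>2)) \<and>
    (\<forall>K z. cmod z < 1 \<longrightarrow> (\<Sum>k<K. cmod (f k z)) \<le> C\<^sup>2) \<and>
    (\<forall>k l. k < N \<longrightarrow> l < N \<longrightarrow>
       hol_calc (f k) (A l) = (if k = l then 1 else 0) \<cdot>\<^sub>m 1\<^sub>m (dim_row (A l)))" for N f
  have "\<exists>f. good N f" for N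
    unfolding good_def by (rule finite_Beurling[OF C, where N = N]) blast+
  then obtain G where G: "\<And>N. good N (G N)"
    by metis
  define lim where "lim k s f \<longleftrightarrow> f \<in> Hinf_ball (C\<^sup>2) \<and>
    (\<forall>z. cmod z < 1 \<longrightarrow> (\<lambda>m. G (s m) k z) \<longlonglongrightarrow> f z) \<and>
    uniform_limit (cball 0 (1/2)) (\<lambda>m. G (s m) k) f sequentially"
    for k and s :: "nat \<Rightarrow> nat" and f
  interpret subseqs "\<lambda>k s. \<exists>f. lim k s f"
  proof
    fix k and s :: "nat \<Rightarrow> nat"
    have "G (s m) k \<in> Hinf_ball (C\<^sup>2)" for m
      using G by (simp add: good_def)
    then obtain f r where "f \<in> Hinf_ball (C\<^sup>2)" "strict_mono (r :: nat \<Rightarrow> nat)"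
      "\<And>z. cmod z < 1 \<Longrightarrow> (\<lambda>m. G (s (r m)) k z) \<longlonglongrightarrow> f z"
      "uniform_limit (cball 0 (1/2)) ((\<lambda>m. G (s m) k) \<circ> r) f sequentially"
      by (rule Hinf_ball_Montel[of "\<lambda>m. G (s m) k"]) blast
    then show "\<exists>r. strict_mono r \<and> (\<exists>f. lim k (s \<circ> r) f)"
      by (auto simp: lim_def o_def)
  qed
  \<comment> \<open>Only after \<open>Suc k\<close> terms is the diagonal sequence a subsequence of
    the one extracted for \<open>k\<close>, hence the shift.\<close>
  have "\<exists>f. lim k (diagseq \<circ> (+) (Suc k)) f" for k
  proof (rule diagseq_holds)
    fix r s :: "nat \<Rightarrow> nat" and k
    assume r: "strict_mono r" and "\<exists>f. lim k s f"
    then obtain f where f: "lim k s f" by blast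
    have "lim k (s \<circ> r) f"
      using f unfolding lim_def o_def
      by (intro conjI allI impI filterlim_compose[OF _ filterlim_subseq[OF r]]) simp_all
    then show "\<exists>f. lim k (s \<circ> r) f" by blast
  qed
  then obtain f where f: "\<And>k. lim k (diagseq \<circ> (+) (Suc k)) (f k)"
    by metis
  show ?thesis
  proof (rule that[of f])
    show "f k \<in> Hinf_ball (C\<^sup>2)" for k
      using f by (simp add: lim_def)
  next
    fix K z assume z: "cmod z < 1"
    \<comment> \<open>The shift depends on \<open>k\<close>; it is undone so that all summands share
      one index sequence.\<close>
    have "(\<lambda>m. G (diagseq m) k z) \<longlonglongrightarrow> f k z" for k
    proof (rule LIMSEQ_offset)
      show "(\<lambda>m. G (diagseq (m + Suc k)) k z) \<longlonglongrightarrow> f k z"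
        using f[of k] z unfolding lim_def o_def by (subst add.commute) blast
    qed
    then have "(\<lambda>m. \<Sum>k<K. cmod (G (diagseq m) k z)) \<longlonglongrightarrow> (\<Sum>k<K. cmod (f k z))"
      by (intro tendsto_intros)
    then show "(\<Sum>k<K. cmod (f k z)) \<le> C\<^sup>2"
      by (rule LIMSEQ_le_const2) (use G z in \<open>auto simp: good_def\<close>)
  next
    fix k l
    let ?s = "diagseq \<circ> (+) (Suc k)"
    \<comment> \<open>\<open>good\<close> controls only indices below \<open>?s m\<close>, which is
      at least \<open>Suc k + m\<close> and so exceeds both \<open>k\<close> and \<open>l\<close>
      once \<open>m > l\<close>.\<close>
    have ev: "\<forall>\<^sub>F m in sequentially.
        hol_calc (G (?s m) k) (A l) = (if k = l then 1 else 0) \<cdot>\<^sub>m 1\<^sub>m (dim_row (A l))"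
      using eventually_gt_at_top[of l]
    proof eventually_elim
      case (elim m)
      then have "k < ?s m" "l < ?s m"
        using seq_suble[OF subseq_diagseq, of "Suc k + m"] by (auto simp del: add_Suc)
      then show ?case
        using G[of "?s m"] unfolding good_def by blast
    qed
    show "hol_calc (f k) (A l) = (if k = l then 1 else 0) \<cdot>\<^sub>m 1\<^sub>m (dim_row (A l))"
    proof (rule disc_mat.hol_calc_limit_eqI[OF disc_mat _ _ ev])
      show "G (?s m) k \<in> Hinf_ball (C\<^sup>2)" for m
        using G[of "?s m"] unfolding good_def by blast
      show "uniform_limit (cball 0 (1/2)) (\<lambda>m. G (?s m) k) (f k) sequentially"
        using f[of k] unfolding lim_def by blast
    qed
  qed
qed

end

theorem theorem4p1:
  fixes A :: "nat \<Rightarrow> complex mat"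
  assumes "\<And>n. square_mat (A n)"
    and "\<And>n. spectrum (A n) \<subseteq> ball 0 1"
    and "interpolating_Hinf A"
  shows "\<exists>f :: nat \<Rightarrow> complex \<Rightarrow> complex.
           (\<forall>n. f n \<in> Hinf) \<and>
           (SUP z\<in>ball 0 1. \<Sum>n. ennreal (cmod (f n z))) < \<infinity> \<and>
           (\<forall>n k. hol_calc (f n) (A k) = (if n = k then 1 else 0) \<cdot>\<^sub>m 1\<^sub>m (dim_row (A k)))"
proof -
  have disc: "disc_mat (A k) (dim_row (A k))" for k
    using assms(1,2)[of k] by (intro disc_mat.intro) (auto intro: carrier_matI)
  interpret disc_mats A
    by (rule disc_mats.intro) (rule disc)
  have "\<exists>M. interpolable M x" if x: "range x \<subseteq> cball 0 1" for x
  proof -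
    \<comment> \<open>The hypothesis is applied to the constant functions with values
      \<open>x k\<close>.\<close>
    have "Hinf_norm (\<lambda>_. c) = cmod c" for c
      by (simp add: Hinf_norm_def)
    moreover have "cmod (x k) \<le> 1" for k
      using x by (auto simp: image_subset_iff)
    ultimately have "bounded (range (\<lambda>k. Hinf_norm (\<lambda>_. x k)))"
      by (auto simp: bounded_iff intro!: exI[of _ 1])
    then obtain f where "f \<in> Hinf" "\<And>k. hol_calc f (A k) = hol_calc (\<lambda>_. x k) (A k)"
      using assms(3)[unfolded interpolating_Hinf_def, rule_format, of "\<lambda>k _. x k"] by auto
    then show ?thesis
      using disc_mat.hol_calc_const[OF disc] unfolding Hinf_iff_Hinf_ball interpolable_def by metis
  qed
  then obtain C where C: "\<And>x. range x \<subseteq> cball 0 1 \<Longrightarrow> interpolable C x"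
    using interpolation_constant by metis
  obtain f where f: "\<And>k. f k \<in> Hinf_ball (C\<^sup>2)"
    "\<And>K z. cmod z < 1 \<Longrightarrow> (\<Sum>k<K. cmod (f k z)) \<le> C\<^sup>2"
    "\<And>k l. hol_calc (f k) (A l) = (if k = l then 1 else 0) \<cdot>\<^sub>m 1\<^sub>m (dim_row (A l))"
    using Beurling[OF C] by metis
  have "(\<Sum>n. ennreal (cmod (f n z))) \<le> ennreal (C\<^sup>2)" if "z \<in> ball 0 1" for z
    using f(2)[of z] that by (intro suminf_le_const) (auto simp: sum_ennreal intro!: ennreal_leI)
  then have "(SUP z\<in>ball 0 1. \<Sum>n. ennreal (cmod (f n z))) \<le> ennreal (C\<^sup>2)"
    by (rule SUP_least)
  also have "\<dots> < \<infinity>"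
    by simp
  finally show ?thesis
    using f(1,3) by (intro exI[of _ f]) (auto simp: Hinf_iff_Hinf_ball)
qed

end
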